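(* Let $I, l_j, F_j, a_j, \delta_j$ be as in the context. Let $\alpha=\max_{1\le j\le N}|a_j|<1$ and suppose that $\delta=\max_{1\le j\le N}|\delta_j|<1$. Then the fixed point $f\in\mathcal{B}(I)$ of the Read-Bajraktarević operator $T$ described in the context is Riemann integrable on $I$.
   Context: Rakotch contraction: let $(X,\rho)$ be a metric space and $\mathbb{R}_+=[0,\infty)$. A map $g:X\to X$ is a Rakotch contraction with respect to a function $\psi:\mathbb{R}_+\to\mathbb{R}_+$ if $\rho(g(x),g(y))\le\psi(\rho(x,y))$ for all $x,y\in X$, where $\psi$ satisfies $\frac{\psi(s)}{s}<1$ for all $s>0$ and $\frac{\psi(t)}{t}\le\frac{\psi(s)}{s}$ for all $t>s>0$. Setting: $N>1$ is an integer, $t_0<t_1<\dots<t_N$ are real numbers, $I=[t_0,t_N]$, $I_j=[t_{j-1},t_j)$ for $1\le j\le N-1$, and $I_N=[t_{N-1},t_N]$. For $1\le j\le N$, $l_j:I\to I$ is the affine map $l_j(t)=a_jt+b_j$ determined by $l_j(t_0)=t_{j-1}$ and $l_j(t_N)=t_j$. The maps $F_j:I\times\mathbb{R}\to\mathbb{R}$ are $F_j(t,x)=c_jt+\delta_js_j(x)+d_j$, where $s_1,\dots,s_N:\mathbb{R}\to\mathbb{R}$ are Rakotch contractions (for the usual metric on $\mathbb{R}$) all with respect to the same function $\psi$, and $c_j,d_j,\delta_j$ are real constants. $\mathcal{B}(I)$ is the space of bounded real-valued functions on $I$ with the norm $\|h\|_\infty=\sup_{t\in I}|h(t)|$. The Read-Bajraktarević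 operator $T:\mathcal{B}(I)\to\mathcal{B}(I)$ is defined by $Th(t)=F_j(l_j^{-1}(t),h(l_j^{-1}(t)))=c_jl_j^{-1}(t)+\delta_js_j(h(l_j^{-1}(t)))+d_j$ for $t\in I_j$, $1\le j\le N$. It is known that, when $\max_j|\delta_j|<1$, $T$ has a unique fixed point $f\in\mathcal{B}(I)$. *)

theory Defs
  imports "HOL-Analysis.Analysis"
begin

definition rakotch_contraction :: "('a::metric_space \<Rightarrow> 'a) \<Rightarrow> (real \<Rightarrow> real) \<Rightarrow> bool" where
  "rakotch_contraction g \<psi> \<longleftrightarrow>
     (\<forall>s\<ge>0. 0 \<le> \<psi> s) \<and>
     (\<forall>s>0. \<psi> s / s < 1) \<and>
     (\<forall>s t. 0 < s \<and> s < t \<longrightarrow> \<psi> t / t \<le> \<psi> s / s) \<and>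
     (\<forall>x y. dist (g x) (g y) \<le> \<psi> (dist x y))"

text \<open>Functions on \<open>A\<close> are represented by total functions that are \<^const>\<open>undefined\<close> off \<open>A\<close>,
  so that equality of two elements is equality on \<open>A\<close>.\<close>

definition bounded_funs :: "real set \<Rightarrow> (real \<Rightarrow> real) set" where
  "bounded_funs A = {h \<in> extensional A. bounded (h ` A)}"

definition subinterval :: "nat \<Rightarrow> (nat \<Rightarrow> real) \<Rightarrow> nat \<Rightarrow> real set" where
  "subinterval N t j = (if j = N then {t (j - 1)..t j} else {t (j - 1)..<t j})"

text \<open>For \<open>t 0 < \<dots> < t N\<close> the subintervals with index in \<open>{1..N}\<close> partition \<open>{t 0..t N}\<close>,
  so the index \<open>j\<close> selected below exists and is unique.\<close>

definition read_bajraktarevic ::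
  "nat \<Rightarrow> (nat \<Rightarrow> real) \<Rightarrow> (nat \<Rightarrow> real \<Rightarrow> real) \<Rightarrow> (nat \<Rightarrow> real \<Rightarrow> real \<Rightarrow> real)
    \<Rightarrow> (real \<Rightarrow> real) \<Rightarrow> real \<Rightarrow> real" where
  "read_bajraktarevic N t l F h =
     (\<lambda>x\<in>{t 0..t N}.
        let j = (THE j. j \<in> {1..N} \<and> x \<in> subinterval N t j);
            y = inv_into {t 0..t N} (l j) x
        in F j y (h y))"

text \<open>The integral of the library is the Henstock--Kurzweil integral, where the fineness of a tagged
  division is measured by a gauge. The Riemann integral requires a uniform mesh bound instead;
  for an interval \<open>K\<close> of reals, \<open>measure lborel K\<close> is its length.\<close>

definition riemann_integrable_on :: "(real \<Rightarrow> real) \<Rightarrow> real \<Rightarrow> real \<Rightarrow> bool" where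
  "riemann_integrable_on f a b \<longleftrightarrow>
     (\<exists>L. \<forall>e>0. \<exists>d>0. \<forall>D.
        D tagged_division_of {a..b} \<and> (\<forall>(x, K)\<in>D. measure lborel K < d) \<longrightarrow>
        \<bar>(\<Sum>(x, K)\<in>D. measure lborel K * f x) - L\<bar> < e)"

end

theory Submission
  imports Defs
begin

text \<open>If \<open>f\<close> oscillates by at most \<open>e\<close> on all short intervals that avoid a finite set \<open>S\<close>,
  then the functional equation shows that it oscillates by at most \<open>\<delta> e + \<eta>\<close> on all shorter intervals
  that avoid the images of \<open>S\<close> under the maps \<open>l j\<close> and the nodes \<open>t j\<close>. Iterating from
  the trivial bound given by boundedness makes the oscillation arbitrarily small,
  so \<open>f\<close> is a regulated function. Its Riemann sums converge because only the intervals within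
  the mesh size of \<open>S\<close> can contribute more than \<open>e\<close> times their length to the error.\<close>

section \<open>Regulated functions and their Riemann integrability\<close>

text \<open>On a compact interval, having this for every \<open>e > 0\<close> means being regulated:
  the points of \<open>S\<close> absorb the jumps larger than \<open>e\<close>. Since the closed
  interval from \<open>x\<close> to \<open>y\<close> must miss \<open>S\<close>, nothing is asked of
  the values of \<open>f\<close> on \<open>S\<close> itself.\<close>

definition osc_le_off_finite :: "(real \<Rightarrow> real) \<Rightarrow> real set \<Rightarrow> real \<Rightarrow> bool" where
  "osc_le_off_finite f A e \<longleftrightarrow>
     (\<exists>S r. finite S \<and> 0 < r \<and>
        (\<forall>x\<in>A. \<forall>y\<in>A. x \<le> y \<and> y - x < r \<and> {x..y} \<inter> S = {} \<longrightarrow> \<bar>f x - f y\<bar> \<le> e))"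

text \<open>Every discontinuity lies in one of the finite exceptional sets belonging to the bounds
  \<open>1/(n+1)\<close>, or is \<open>p\<close> or \<open>q\<close>, where the extension by zero
  may jump. A function continuous off a countable set is Borel.\<close>

lemma regulated_borel_measurable:
  fixes f :: "real \<Rightarrow> real"
  assumes osc: "\<And>e. e > 0 \<Longrightarrow> osc_le_off_finite f {p..q} e"
  shows "(\<lambda>x. if x \<in> {p<..<q} then f x else 0) \<in> borel_measurable borel"
proof -
  let ?g = "\<lambda>x. if x \<in> {p<..<q} then f x else 0"
  have "\<forall>n. \<exists>S r. finite S \<and> 0 < r \<and>
      (\<forall>x\<in>{p..q}. \<forall>y\<in>{p..q}. x \<le> y \<and> y - x < r \<and> {x..y} \<inter> S = {} \<longrightarrow>
         \<bar>f x - f y\<bar> \<le> inverse (real (Suc n)))"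
    using osc unfolding osc_le_off_finite_def by simp
  then obtain S r where S: "\<And>n. finite (S n)" and r: "\<And>n. 0 < r n"
    and *: "\<And>n x y. x \<in> {p..q} \<Longrightarrow> y \<in> {p..q} \<Longrightarrow> x \<le> y \<Longrightarrow> y - x < r n \<Longrightarrow> {x..y} \<inter> S n = {}
       \<Longrightarrow> \<bar>f x - f y\<bar> \<le> inverse (real (Suc n))"
    by metis
  define X where "X = (\<Union>n. S n) \<union> {p, q}"
  have X: "countable X" unfolding X_def using S by (auto intro: countable_finite)
  have "isCont ?g x" if x: "x \<notin> X" for x
  proof (cases "x \<in> {p<..<q}")
    case False
    then have "x < p \<or> q < x" using x unfolding X_def by auto
    then have "x \<in> {..<p} \<union> {q<..}" by auto
    moreover have "open ({..<p} \<union> {q<..})" by auto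
    ultimately have "\<forall>\<^sub>F y in nhds x. y \<in> {..<p} \<union> {q<..}"
      using eventually_nhds_in_open by blast
    then have "\<forall>\<^sub>F y in nhds x. ?g y = 0"
      by (rule eventually_mono) auto
    then show ?thesis using isCont_cong[of ?g "\<lambda>_. 0" x] by simp
  next
    case True
    show ?thesis unfolding continuous_at_eps_delta
    proof (intro allI impI)
      fix e :: real assume "e > 0"
      then obtain n where n: "inverse (real (Suc n)) < e" using reals_Archimedean by blast
      \<comment> \<open>Finite sets are closed, so a whole ball around \<open>x\<close> avoids
        \<open>S n\<close>; it is convex and hence contains the interval between \<open>x\<close>
        and any nearby \<open>y\<close>.\<close>
      have "open ({p<..<q} - S n)" using S finite_imp_closed by (intro open_Diff) auto
      moreover have "x \<in> {p<..<q} - S n" using True x unfolding X_def by auto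
      ultimately obtain k where k: "k > 0" "ball x k \<subseteq> {p<..<q} - S n"
        using open_contains_ball by metis
      show "\<exists>d>0. \<forall>x'. dist x' x < d \<longrightarrow> dist (?g x') (?g x) < e"
      proof (intro exI[of _ "min k (r n)"] conjI allI impI)
        show "0 < min k (r n)" using k r by simp
        fix y assume y: "dist y x < min k (r n)"
        have I: "{min x y..max x y} \<subseteq> ball x k"
          using y by (auto simp: dist_real_def min_def max_def split: if_splits)
        have "y \<in> ball x k" using y by (simp add: dist_commute)
        then have yI: "y \<in> {p<..<q}" using k by auto
        have "\<bar>f (min x y) - f (max x y)\<bar> \<le> inverse (real (Suc n))"
        proof (rule *)
          show "{min x y..max x y} \<inter> S n = {}" using I k(2) by blast
          show "max x y - min x y < r n" using y by (auto simp: dist_real_def min_def[of x y] max_def[of x y])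
        qed (use yI True in \<open>auto simp: min_def max_def\<close>)
        then have "\<bar>f y - f x\<bar> < e" using n by (auto simp: min_def max_def split: if_splits)
        then show "dist (?g y) (?g x) < e" using yI True by (simp add: dist_real_def)
      qed
    qed
  qed
  then have "continuous_on (- X) ?g" by (simp add: continuous_at_imp_continuous_on)
  then show ?thesis using X by (rule borel_measurable_continuous_countable_exceptions[rotated])
qed

text \<open>A bounded measurable function on a compact interval is integrable, and setting the
  values at \<open>p\<close> and \<open>q\<close> to zero changes \<open>f\<close> only on a finite
  set.\<close>

lemma regulated_integrable:
  fixes f :: "real \<Rightarrow> real"
  assumes osc: "\<And>e. e > 0 \<Longrightarrow> osc_le_off_finite f {p..q} e"
    and bdd: "\<And>x. x \<in> {p..q} \<Longrightarrow> \<bar>f x\<bar> \<le> M"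
  shows "f integrable_on {p..q}"
proof -
  let ?g = "\<lambda>x. if x \<in> {p<..<q} then f x else 0"
  have "?g \<in> borel_measurable (lebesgue_on {p..q})"
    using regulated_borel_measurable[OF osc]
    by (intro measurable_restrict_space1 measurable_completion) simp
  then have "?g integrable_on {p..q}"
  proof (rule measurable_bounded_by_integrable_imp_integrable)
    show "(\<lambda>_. \<bar>M\<bar>) integrable_on {p..q}" by (rule integrable_const_ivl)
    show "norm (?g x) \<le> \<bar>M\<bar>" if "x \<in> {p..q}" for x using bdd[of x] that by auto
  qed auto
  then show ?thesis
    by (rule integrable_spike_finite[of "{p, q}", rotated 2]) auto
qed

text \<open>The error of a Riemann sum on each piece is at most the integral over that piece of a
  step function \<open>w\<close>. Summing over the pieces gives the integral of \<open>w\<close>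
  over the whole interval, a bound that does not depend on the division.\<close>

lemma regulated_riemann_integrable:
  fixes f :: "real \<Rightarrow> real"
  assumes osc: "\<And>e. e > 0 \<Longrightarrow> osc_le_off_finite f {p..q} e"
    and bdd: "\<And>x. x \<in> {p..q} \<Longrightarrow> \<bar>f x\<bar> \<le> M" and "p \<le> q"
  shows "riemann_integrable_on f p q"
  unfolding riemann_integrable_on_def
proof (rule exI[of _ "integral {p..q} f"], intro allI impI)
  fix e :: real assume e: "e > 0"
  have M: "0 \<le> M" using bdd[of p] \<open>p \<le> q\<close> by auto
  have fint: "f integrable_on {p..q}" using regulated_integrable[OF osc bdd] .
  \<comment> \<open>Half of \<open>e\<close> is reserved for the pieces away from \<open>S\<close>.
    The added 1 keeps the denominator positive when \<open>p = q\<close> and makes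
    \<open>e' * (q - p) < e / 2\<close> strict.\<close>
  define e' where "e' = e / (2 * (q - p + 1))"
  have e': "e' > 0" unfolding e'_def using e \<open>p \<le> q\<close> by simp
  from osc[OF this] obtain S r where S: "finite S" and r: "0 < r"
    and *: "\<And>x y. x \<in> {p..q} \<Longrightarrow> y \<in> {p..q} \<Longrightarrow> x \<le> y \<Longrightarrow> y - x < r \<Longrightarrow> {x..y} \<inter> S = {}
       \<Longrightarrow> \<bar>f x - f y\<bar> \<le> e'"
    unfolding osc_le_off_finite_def by blast
  \<comment> \<open>The bound \<open>r\<close> makes the oscillation estimate available on each
    piece avoiding \<open>S\<close>. The other bound gives
    \<open>4 * M * card S * d \<le> e / 2\<close>, the share of the intervals of length
    \<open>2 * d\<close> around \<open>S\<close>; the added ones cover \<open>M = 0\<close> and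
    empty \<open>S\<close>.\<close>
  define d where "d = min r (e / (8 * (M + 1) * (real (card S) + 1)))"
  have d: "d > 0" "d \<le> r" unfolding d_def using r e M by auto
  have "d \<le> e / (8 * (M + 1) * (real (card S) + 1))" unfolding d_def by simp
  moreover have "0 < 8 * (M + 1) * (real (card S) + 1)" using M by simp
  ultimately have "d * (8 * (M + 1) * (real (card S) + 1)) \<le> e"
    by (simp only: pos_le_divide_eq)
  then have dM: "8 * ((M + 1) * (real (card S) + 1) * d) \<le> e" by (simp only: mult_ac)
  \<comment> \<open>On an interval of length less than \<open>d\<close> with tag \<open>x\<close>, \<open>w y\<close> dominates \<open>\<bar>f x - f y\<bar>\<close>.\<close>
  define w where "w y = e' + 2 * M * (\<Sum>\<sigma>\<in>S. indicator {\<sigma> - d..\<sigma> + d} y)" for y :: real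
  have ind: "(indicator {\<sigma> - d..\<sigma> + d} has_integral measure lborel ({\<sigma> - d..\<sigma> + d} \<inter> {u..v})) {u..v}"
    for \<sigma> u v :: real
  proof -
    have "((\<lambda>_. 1) has_integral measure lborel ({\<sigma> - d..\<sigma> + d} \<inter> {u..v})) ({\<sigma> - d..\<sigma> + d} \<inter> {u..v})"
      by (intro has_integral_measure_lborel) (auto simp: Int_atLeastAtMost emeasure_lborel_Icc_eq)
    then have "((\<lambda>x. if x \<in> {\<sigma> - d..\<sigma> + d} then 1 else 0) has_integral
        measure lborel ({\<sigma> - d..\<sigma> + d} \<inter> {u..v})) {u..v}"
      by (simp only: has_integral_restrict_Int)
    moreover have "(\<lambda>x. if x \<in> {\<sigma> - d..\<sigma> + d} then 1 else 0 :: real) = indicator {\<sigma> - d..\<sigma> + d}"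
      by (auto simp: indicator_def)
    ultimately show ?thesis by simp
  qed
  have wint: "w integrable_on {u..v}" for u v
    unfolding w_def
    by (intro Henstock_Kurzweil_Integration.integrable_add integrable_const_ivl integrable_on_mult_right Henstock_Kurzweil_Integration.integrable_sum[OF S])
       (use ind in blast)
  have "integral {p..q} w \<le> e' * (q - p) + 2 * M * (\<Sum>\<sigma>\<in>S. 2 * d)"
  proof -
    have "integral {p..q} w = e' * (q - p) + 2 * M * (\<Sum>\<sigma>\<in>S. measure lborel ({\<sigma> - d..\<sigma> + d} \<inter> {p..q}))"
      unfolding w_def
      by (intro integral_unique has_integral_add has_integral_mult_right has_integral_sum[OF S] ind)
         (use has_integral_const_real[of e' p q] \<open>p \<le> q\<close> in \<open>simp add: mult.commute\<close>)
    also have "\<dots> \<le> e' * (q - p) + 2 * M * (\<Sum>\<sigma>\<in>S. 2 * d)"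
    proof (intro add_left_mono mult_left_mono sum_mono)
      fix \<sigma>
      have "measure lborel ({\<sigma> - d..\<sigma> + d} \<inter> {p..q}) \<le> measure lborel {\<sigma> - d..\<sigma> + d}"
        by (intro measure_mono_fmeasurable fmeasurableI) (auto simp: emeasure_lborel_Icc_eq)
      then show "measure lborel ({\<sigma> - d..\<sigma> + d} \<inter> {p..q}) \<le> 2 * d" using d by simp
    qed (use M in auto)
    finally show ?thesis .
  qed
  also have "\<dots> < e"
  proof -
    have "e' * (q - p) < e / 2" unfolding e'_def using e \<open>p \<le> q\<close>
      by (simp add: field_simps)
    moreover have "M * real (card S) * d \<le> (M + 1) * (real (card S) + 1) * d"
      using M d by (intro mult_right_mono mult_mono) auto
    moreover have "2 * M * (\<Sum>\<sigma>\<in>S. 2 * d) = 4 * (M * real (card S) * d)" by simp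
    ultimately show ?thesis using dM by linarith
  qed
  finally have w_less: "integral {p..q} w < e" .
  show "\<exists>d>0. \<forall>D. D tagged_division_of {p..q} \<and> (\<forall>(x, K)\<in>D. measure lborel K < d) \<longrightarrow>
      \<bar>(\<Sum>(x, K)\<in>D. measure lborel K * f x) - integral {p..q} f\<bar> < e"
  proof (intro exI[of _ d] conjI allI impI d)
    fix D assume "D tagged_division_of {p..q} \<and> (\<forall>(x, K)\<in>D. measure lborel K < d)"
    then have D: "D tagged_division_of {p..q}" and mesh: "\<And>x K. (x, K) \<in> D \<Longrightarrow> measure lborel K < d"
      by auto
    have Df: "integral {p..q} f = (\<Sum>(x, K)\<in>D. integral K f)"
      using integral_combine_tagged_division_topdown[of f p q D] fint D by simp
    have Dw: "integral {p..q} w = (\<Sum>(x, K)\<in>D. integral K w)"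
      using integral_combine_tagged_division_topdown[of w p q D] wint D by simp
    have piece: "\<bar>measure lborel K * f x - integral K f\<bar> \<le> integral K w" if xK: "(x, K) \<in> D" for x K
    proof -
      obtain u v where K: "K = {u..v}" using tagged_division_ofD(4)[OF D xK] by auto
      have x: "x \<in> {u..v}" and sub: "{u..v} \<subseteq> {p..q}" using tagged_division_ofD(2,3)[OF D xK] K by auto
      have vu: "v - u < d" using mesh[OF xK] K x by simp
      have fK: "f integrable_on {u..v}" using integrable_on_subinterval[OF fint sub] .
      have c: "((\<lambda>_. f x) has_integral measure lborel K * f x) {u..v}"
        using has_integral_const_real[of "f x" u v] K by simp
      have diff: "((\<lambda>y. f x - f y) has_integral measure lborel K * f x - integral K f) {u..v}"
        unfolding K using has_integral_diff[OF c[unfolded K] integrable_integral[OF fK]] .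
      have le: "\<bar>f x - f y\<bar> \<le> w y" if y: "y \<in> {u..v}" for y
      \<comment> \<open>A piece that misses \<open>S\<close> has oscillation at most
        \<open>e'\<close>. A piece that meets \<open>S\<close> lies within \<open>d\<close> of some
        \<open>\<sigma>\<close>, so an indicator in \<open>w\<close> equals 1 and contributes the
        trivial bound \<open>2 * M\<close>.\<close>
      proof (cases "{u..v} \<inter> S = {}")
        case True
        have "\<bar>f (min x y) - f (max x y)\<bar> \<le> e'"
        proof (rule *)
          have "{min x y..max x y} \<subseteq> {u..v}" using x y by (auto simp: min_def max_def)
          then show "{min x y..max x y} \<inter> S = {}" using True by blast
          show "max x y - min x y < r" using x y vu d by (simp add: min_def max_def)
          show "min x y \<in> {p..q}" "max x y \<in> {p..q}" using x y sub by (auto simp: min_def max_def)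
        qed simp
        moreover have "0 \<le> (\<Sum>\<sigma>\<in>S. indicator {\<sigma> - d..\<sigma> + d} y :: real)" by (intro sum_nonneg) auto
        then have "e' \<le> w y" unfolding w_def using M by simp
        ultimately show ?thesis by (auto simp: min_def max_def split: if_splits)
      next
        case False
        then obtain \<sigma> where \<sigma>: "\<sigma> \<in> S" "\<sigma> \<in> {u..v}" by blast
        then have "y \<in> {\<sigma> - d..\<sigma> + d}" using y vu by auto
        then have "1 = (indicator {\<sigma> - d..\<sigma> + d} y :: real)" by simp
        also have "\<dots> \<le> (\<Sum>\<sigma>\<in>S. indicator {\<sigma> - d..\<sigma> + d} y)"
          using S \<sigma> by (intro member_le_sum) auto
        finally have "2 * M * 1 \<le> 2 * M * (\<Sum>\<sigma>\<in>S. indicator {\<sigma> - d..\<sigma> + d} y)"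
          using M by (intro mult_left_mono) auto
        moreover have "\<bar>f x\<bar> \<le> M" "\<bar>f y\<bar> \<le> M" using bdd x y sub by blast+
        ultimately show ?thesis unfolding w_def using e' by linarith
      qed
      have "norm (integral {u..v} (\<lambda>y. f x - f y)) \<le> integral {u..v} w"
        by (rule Henstock_Kurzweil_Integration.integral_norm_bound_integral) (use diff wint le in auto)
      then show ?thesis using integral_unique[OF diff] K by simp
    qed
    have "\<bar>(\<Sum>(x, K)\<in>D. measure lborel K * f x) - integral {p..q} f\<bar>
        = \<bar>\<Sum>(x, K)\<in>D. measure lborel K * f x - integral K f\<bar>"
      unfolding Df by (simp add: sum_subtractf case_prod_unfold)
    also have "\<dots> \<le> (\<Sum>(x, K)\<in>D. \<bar>measure lborel K * f x - integral K f\<bar>)"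
      unfolding case_prod_unfold by (rule sum_abs)
    also have "\<dots> \<le> integral {p..q} w"
      unfolding Dw by (intro sum_mono) (use piece in auto)
    also have "\<dots> < e" by (rule w_less)
    finally show "\<bar>(\<Sum>(x, K)\<in>D. measure lborel K * f x) - integral {p..q} f\<bar> < e" .
  qed
qed

section \<open>Rakotch contractions and the partition into subintervals\<close>

text \<open>At a distance \<open>r > 0\<close> the ratio condition gives
  \<open>\<psi> r < r\<close>. It says nothing at 0, but there both sides vanish. This lets the maps
  \<open>s j\<close> pass on an oscillation bound unchanged.\<close>

lemma rakotch_contraction_dist_le:
  assumes "rakotch_contraction g \<psi>"
  shows "dist (g x) (g y) \<le> dist x y"
proof (cases "x = y")
  case False
  then have "dist x y > 0" by simp
  then have "\<psi> (dist x y) < dist x y"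
    using assms unfolding rakotch_contraction_def by (metis divide_less_eq_1_pos)
  then show ?thesis using assms unfolding rakotch_contraction_def by (meson less_imp_le order_trans)
qed simp

lemma subinterval_cover:
  assumes "x \<in> {t 0..t N}" "0 < N"
  obtains j where "j \<in> {1..N}" "x \<in> subinterval N t j"
proof -
  \<comment> \<open>The first node beyond \<open>x\<close> closes its subinterval. The alternative
    \<open>j = N\<close> guarantees that an index exists and sends \<open>x = t N\<close> to the
    last, closed subinterval.\<close>
  define j where "j = (LEAST j. 0 < j \<and> (x < t j \<or> j = N))"
  have j: "0 < j \<and> (x < t j \<or> j = N)" unfolding j_def by (rule LeastI[of _ N]) (use assms in auto)
  have jN: "j \<le> N" unfolding j_def by (rule Least_le) (use assms in auto)
  have "t (j - 1) \<le> x"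
  proof (cases "j = 1")
    case False
    then have "j - 1 < j" "0 < j - 1" using j by auto
    then show ?thesis using not_less_Least[of "j - 1" "\<lambda>j. 0 < j \<and> (x < t j \<or> j = N)"]
      unfolding j_def[symmetric] by auto
  qed (use assms in simp)
  then have "x \<in> subinterval N t j" using j assms(1) unfolding subinterval_def by auto
  then show thesis using that[of j] j jN by auto
qed

lemma subinterval_unique:
  assumes mono: "\<And>i j. i < j \<Longrightarrow> j \<le> N \<Longrightarrow> t i < t j"
    and "j \<in> {1..N}" "x \<in> subinterval N t j" "k \<in> {1..N}" "x \<in> subinterval N t k"
  shows "j = k"
proof -
  \<comment> \<open>The smaller index is not \<open>N\<close>, so its subinterval is open on the
    right and ends no later than the other begins.\<close>
  have False if "i < k" "i \<in> {1..N}" "k \<in> {1..N}" "x \<in> subinterval N t i" "x \<in> subinterval N t k" for i k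
  proof -
    have "x < t i" "t (k - 1) \<le> x" using that unfolding subinterval_def by (auto split: if_splits)
    moreover have "t i \<le> t (k - 1)"
      using that mono[of i "k - 1"] by (cases "i = k - 1") fastforce+
    ultimately show False by simp
  qed
  then show ?thesis using assms by (metis linorder_neqE_nat)
qed

section \<open>Oscillation of the fixed point under the functional equation\<close>

theorem theorem3:
  fixes N :: nat and t a b c d \<delta> :: "nat \<Rightarrow> real" and I :: "real set"
    and l s :: "nat \<Rightarrow> real \<Rightarrow> real" and F :: "nat \<Rightarrow> real \<Rightarrow> real \<Rightarrow> real"
    and \<psi> f :: "real \<Rightarrow> real"
  assumes "N > 1"
    and "\<And>i j. i < j \<Longrightarrow> j \<le> N \<Longrightarrow> t i < t j"
    and "I = {t 0..t N}"
    and "\<And>j x. j \<in> {1..N} \<Longrightarrow> x \<in> I \<Longrightarrow> l j x = a j * x + b j"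
    and "\<And>j. j \<in> {1..N} \<Longrightarrow> l j (t 0) = t (j - 1)"
    and "\<And>j. j \<in> {1..N} \<Longrightarrow> l j (t N) = t j"
    and "\<And>j. j \<in> {1..N} \<Longrightarrow> rakotch_contraction (s j) \<psi>"
    and "\<And>j x y. j \<in> {1..N} \<Longrightarrow> x \<in> I \<Longrightarrow> F j x y = c j * x + \<delta> j * s j y + d j"
    and "Max ((\<lambda>j. \<bar>a j\<bar>) ` {1..N}) < 1"
    and "Max ((\<lambda>j. \<bar>\<delta> j\<bar>) ` {1..N}) < 1"
    and "f \<in> bounded_funs I"
    and "read_bajraktarevic N t l F f = f"
  shows "riemann_integrable_on f (t 0) (t N)"
proof -
  note mono = assms(2)
  have t0N: "t 0 < t N" using mono[of 0 N] assms(1) by simp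
  obtain M where M: "\<And>x. x \<in> I \<Longrightarrow> \<bar>f x\<bar> \<le> M"
    using assms(11) unfolding bounded_funs_def bounded_iff by auto
  have M0: "0 \<le> M" using M[of "t 0"] t0N assms(3) by auto
  have ends: "a j * t 0 + b j = t (j - 1)" "a j * t N + b j = t j" if "j \<in> {1..N}" for j
    using that assms(3-6) t0N by (metis atLeastAtMost_iff less_imp_le order_refl)+
  \<comment> \<open>Each \<open>l j\<close> maps \<open>t 0 < t N\<close> to consecutive nodes in
    the same order, so its inverse preserves the order of points.\<close>
  have a_pos: "0 < a j" if j: "j \<in> {1..N}" for j
  proof -
    have "a j * (t N - t 0) = t j - t (j - 1)" using ends[OF j] by (simp add: algebra_simps)
    also have "\<dots> > 0" using mono[of "j - 1" j] j by simp
    finally show ?thesis using t0N by (simp add: zero_less_mult_iff)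
  qed
  \<comment> \<open>The equation is needed only inside the open subintervals, because the nodes will
    belong to the exceptional set; this also treats \<open>j = N\<close> like the other
    indices.\<close>
  have fix_eq: "(x - b j) / a j \<in> I \<and>
      f x = c j * ((x - b j) / a j) + \<delta> j * s j (f ((x - b j) / a j)) + d j"
    if j: "j \<in> {1..N}" and x: "t (j - 1) < x" "x < t j" for j x
  proof -
    let ?u = "(x - b j) / a j"
    have "a j * t 0 \<le> x - b j" "x - b j \<le> a j * t N" using ends[OF j] x by linarith+
    then have u: "?u \<in> I" using a_pos[OF j] assms(3) by (simp add: field_simps)
    have lu: "l j ?u = x" using assms(4)[OF j u] a_pos[OF j] by simp
    have inj: "inj_on (l j) I" using assms(4)[OF j] a_pos[OF j] by (auto intro!: inj_onI)
    have inv: "inv_into I (l j) x = ?u" using inv_into_f_f[OF inj u] lu by simp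
    have xs: "x \<in> subinterval N t j" using x unfolding subinterval_def by auto
    have the: "(THE j. j \<in> {1..N} \<and> x \<in> subinterval N t j) = j"
    proof (rule the_equality)
      show "k = j" if "k \<in> {1..N} \<and> x \<in> subinterval N t k" for k
        by (rule subinterval_unique[of N t k x j]) (use that j xs mono in auto)
    qed (use j xs in auto)
    have "t 0 \<le> t (j - 1)" using mono[of 0 "j - 1"] j by (cases "j = 1") fastforce+
    moreover have "t j \<le> t N" using mono[of j N] j by (cases "j = N") fastforce+
    ultimately have "x \<in> {t 0..t N}" using x by auto
    then have "read_bajraktarevic N t l F f x = F j ?u (f ?u)"
      unfolding read_bajraktarevic_def using the inv assms(3) by (simp add: Let_def)
    then show ?thesis using assms(8)[OF j u] assms(12) u by simp
  qed
  define \<Delta> where "\<Delta> = Max ((\<lambda>j. \<bar>\<delta> j\<bar>) ` {1..N})"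
  have \<Delta>: "\<bar>\<delta> j\<bar> \<le> \<Delta>" if "j \<in> {1..N}" for j unfolding \<Delta>_def using that by simp
  have \<Delta>01: "0 \<le> \<Delta>" "\<Delta> < 1"
    using \<Delta>[of 1] assms(1,10) unfolding \<Delta>_def[symmetric] by auto
  have step: "osc_le_off_finite f I (\<Delta> * e + \<eta>)" if P: "osc_le_off_finite f I e" and \<eta>: "\<eta> > 0" for e \<eta>
  proof -
    obtain S r where S: "finite S" and r: "0 < r"
      and *: "\<And>x y. x \<in> I \<Longrightarrow> y \<in> I \<Longrightarrow> x \<le> y \<Longrightarrow> y - x < r \<Longrightarrow> {x..y} \<inter> S = {}
       \<Longrightarrow> \<bar>f x - f y\<bar> \<le> e"
      using P unfolding osc_le_off_finite_def by blast
    \<comment> \<open>Avoiding the nodes keeps an interval inside one open subinterval, and avoiding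
      the images of \<open>S\<close> makes its preimage avoid \<open>S\<close>.\<close>
    define S' where "S' = t ` {0..N} \<union> (\<Union>j\<in>{1..N}. (\<lambda>u. a j * u + b j) ` S)"
    \<comment> \<open>Inverting \<open>l j\<close> divides lengths by \<open>a j\<close>. The
      preimage must be shorter than \<open>r\<close> for the old bound to apply, and short enough
      that the term \<open>c j * x\<close> varies by at most \<open>\<eta>\<close>; the added 1
      covers \<open>c j = 0\<close>.\<close>
    define r' where "r' = Min ((\<lambda>j. a j * min r (\<eta> / (\<bar>c j\<bar> + 1))) ` {1..N})"
    have r': "0 < r'" unfolding r'_def using assms(1) r \<eta> a_pos by (subst Min_gr_iff) auto
    have r'_le: "r' \<le> a j * min r (\<eta> / (\<bar>c j\<bar> + 1))" if "j \<in> {1..N}" for j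
      unfolding r'_def using that by (intro Min_le) auto
    have "\<bar>f x - f y\<bar> \<le> \<Delta> * e + \<eta>"
      if x: "x \<in> I" and y: "y \<in> I" and xy: "x \<le> y" "y - x < r'" "{x..y} \<inter> S' = {}" for x y
    proof -
      obtain j where j: "j \<in> {1..N}" and xj: "x \<in> subinterval N t j"
        using subinterval_cover[of x t N] x assms(1,3) by auto
      have t_notin: "t i \<notin> {x..y}" if "i \<le> N" for i
        using xy(3) that unfolding S'_def by auto
      have xj': "t (j - 1) \<le> x" "x \<le> t j" using xj unfolding subinterval_def by (auto split: if_splits)
      \<comment> \<open>Neither node adjacent to \<open>x\<close> lies between \<open>x\<close> and
        \<open>y\<close>, so \<open>y\<close> cannot leave the subinterval of \<open>x\<close> and
        both points are interior to it.\<close>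
      have x1: "t (j - 1) < x" "y < t j"
        using t_notin[of "j - 1"] t_notin[of j] xj' xy(1) j by fastforce+
      let ?u = "(x - b j) / a j" and ?v = "(y - b j) / a j"
      have u: "?u \<in> I" and fx: "f x = c j * ?u + \<delta> j * s j (f ?u) + d j"
        using fix_eq[OF j, of x] x1 xy by auto
      have v: "?v \<in> I" and fy: "f y = c j * ?v + \<delta> j * s j (f ?v) + d j"
        using fix_eq[OF j, of y] x1 xy by auto
      have uv: "?u \<le> ?v" using a_pos[OF j] xy(1) by (intro divide_right_mono) auto
      have "y - x < a j * min r (\<eta> / (\<bar>c j\<bar> + 1))" using xy(2) r'_le[OF j] by linarith
      then have "(y - x) / a j < min r (\<eta> / (\<bar>c j\<bar> + 1))"
        using a_pos[OF j] by (simp add: pos_divide_less_eq mult.commute del: min_less_iff_conj)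
      moreover have "?v - ?u = (y - x) / a j" by (simp add: diff_divide_distrib)
      ultimately have d1: "?v - ?u < r" and d2: "?v - ?u < \<eta> / (\<bar>c j\<bar> + 1)" by auto
      have disj: "{?u..?v} \<inter> S = {}"
      proof (rule ccontr)
        assume "{?u..?v} \<inter> S \<noteq> {}"
        then obtain \<sigma> where \<sigma>: "\<sigma> \<in> S" "?u \<le> \<sigma>" "\<sigma> \<le> ?v" by auto
        then have "a j * \<sigma> + b j \<in> {x..y}" using a_pos[OF j] by (simp add: field_simps)
        moreover have "a j * \<sigma> + b j \<in> S'" using \<sigma>(1) j unfolding S'_def by blast
        ultimately show False using xy(3) by blast
      qed
      have "\<bar>s j (f ?u) - s j (f ?v)\<bar> \<le> \<bar>f ?u - f ?v\<bar>"
        using rakotch_contraction_dist_le[OF assms(7)[OF j]] by (simp add: dist_real_def)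
      also have "\<dots> \<le> e" using *[OF u v uv d1 disj] .
      finally have se: "\<bar>s j (f ?u) - s j (f ?v)\<bar> \<le> e" .
      have "\<bar>c j\<bar> * (?v - ?u) \<le> (\<bar>c j\<bar> + 1) * (?v - ?u)" using uv by (intro mult_right_mono) auto
      also have "\<dots> \<le> \<eta>" using d2 by (simp add: pos_less_divide_eq mult.commute)
      finally have c\<eta>: "\<bar>c j * (?u - ?v)\<bar> \<le> \<eta>" using uv by (simp add: abs_mult)
      have "\<bar>\<delta> j * (s j (f ?u) - s j (f ?v))\<bar> \<le> \<Delta> * e"
        unfolding abs_mult using \<Delta>[OF j] se \<Delta>01 by (intro mult_mono) auto
      moreover have "f x - f y = c j * (?u - ?v) + \<delta> j * (s j (f ?u) - s j (f ?v))"
        unfolding fx fy by (simp add: right_diff_distrib)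
      ultimately show ?thesis using c\<eta> by linarith
    qed
    moreover have "finite S'" unfolding S'_def using S by auto
    ultimately show ?thesis unfolding osc_le_off_finite_def using r' by blast
  qed
  \<comment> \<open>The midpoint of \<open>\<Delta>\<close> and 1: with
    \<open>\<eta> = (1 - \<Delta>) / 2 * e\<close>, one step turns the bound \<open>e\<close> into
    \<open>\<kappa> * e\<close>. It is positive even if \<open>\<Delta> = 0\<close>, so every later
    \<open>\<eta>\<close> is positive.\<close>
  define \<kappa> where "\<kappa> = (1 + \<Delta>) / 2"
  have \<kappa>: "0 < \<kappa>" "\<kappa> < 1" unfolding \<kappa>_def using \<Delta>01 by auto
  have iter: "osc_le_off_finite f I (\<kappa> ^ n * (2 * M + 1))" for n
  proof (induction n)
    case 0
    \<comment> \<open>Boundedness alone gives \<open>2 * M\<close>; the extra 1 makes the starting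
      bound positive when \<open>M = 0\<close>.\<close>
    have "\<bar>f x - f y\<bar> \<le> 2 * M + 1" if "x \<in> I" "y \<in> I" for x y
      using M[OF that(1)] M[OF that(2)] by linarith
    then show ?case unfolding osc_le_off_finite_def by (intro exI[of _ "{}"] exI[of _ 1]) auto
  next
    case (Suc n)
    let ?e = "\<kappa> ^ n * (2 * M + 1)"
    have "0 < (1 - \<Delta>) / 2 * ?e" using \<kappa> \<Delta>01 M0 by (intro mult_pos_pos) auto
    from step[OF Suc this] have "osc_le_off_finite f I (\<Delta> * ?e + (1 - \<Delta>) / 2 * ?e)" .
    also have "\<Delta> * ?e + (1 - \<Delta>) / 2 * ?e = \<kappa> ^ Suc n * (2 * M + 1)"
      unfolding \<kappa>_def by (simp add: field_simps)
    finally show ?case .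
  qed
  have "osc_le_off_finite f I e" if "e > 0" for e
  proof -
    have "0 < e / (2 * M + 1)" using that M0 by simp
    then obtain n where "\<kappa> ^ n < e / (2 * M + 1)" using real_arch_pow_inv \<kappa> by blast
    then have "\<kappa> ^ n * (2 * M + 1) \<le> e" using M0 by (simp add: pos_less_divide_eq)
    then show ?thesis using iter[of n] unfolding osc_le_off_finite_def by (meson order_trans)
  qed
  then show ?thesis using regulated_riemann_integrable[of f "t 0" "t N" M] M t0N assms(3) by auto
qed

end
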